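(* Let $r\in\mathbb{Q}$ be such that there exist $a\in\mathbb{Z}$ and $b\in\mathbb{N}$ with $\gcd(a,b)=1$ and $S(a,b)=r$. Then there exists a sequence of pairs $(a_i,b_i)$, $i\in\mathbb{N}$, with $a_i\in\mathbb{Z}$, $b_i\in\mathbb{N}$, $\gcd(a_i,b_i)=1$, such that $b_i\to\infty$ as $i\to\infty$ and $S(a_i,b_i)=r$ for all $i\in\mathbb{N}$.
   Context: For $a\in\mathbb{Z}$, $b\in\mathbb{N}$ with $\gcd(a,b)=1$, the Dedekind sum is $s(a,b)=\sum_{k=1}^{b}((k/b))((ak/b))$, where for real $x$, $((x))=x-\lfloor x\rfloor-1/2$ if $x\notin\mathbb{Z}$ and $((x))=0$ if $x\in\mathbb{Z}$. The normalized Dedekind sum is $S(a,b)=12\,s(a,b)$. *)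

theory Defs
  imports Complex_Main
begin

definition sawtooth :: "real \<Rightarrow> real" where
  "sawtooth x = (if x \<in> \<int> then 0 else x - of_int \<lfloor>x\<rfloor> - 1 / 2)"

definition dedekind_sum :: "int \<Rightarrow> nat \<Rightarrow> real" where
  "dedekind_sum a b =
     (\<Sum>k = 1..b. sawtooth (real k / real b) * sawtooth (of_int a * real k / real b))"

definition normalized_dedekind_sum :: "int \<Rightarrow> nat \<Rightarrow> real" where
  "normalized_dedekind_sum a b = 12 * dedekind_sum a b"

end

theory Submission
  imports Defs
begin

text \<open>Suppose \<open>S(a, b) = r\<close>. For every \<open>n > 0\<close>, with \<open>k = (b n)\<^sup>2 + 1\<close>, also
  \<open>S(a k + b n, b k) = r\<close>. The fraction \<open>(a k + b n) / (b k)\<close> is the image of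
  \<open>(a + b n) / b\<close> under a power of the parabolic element of \<open>SL\<^sub>2(\<int>)\<close> that fixes \<open>a / b\<close>.
  By reciprocity, \<open>S\<close> changes along an edge of the Farey graph by an amount depending only on the
  two denominators. Comparing a Farey path from \<open>a / b\<close> to \<open>(a + b n) / b\<close> with its parabolic
  image, the contributions telescope, which evaluates the change of \<open>S\<close> under a parabolic
  element; in the present case this change vanishes.\<close>

section \<open>Sawtooth function and residues\<close>

lemma sawtooth_add_int: "sawtooth (x + of_int n) = sawtooth x"
  by (simp add: sawtooth_def)

lemma sawtooth_minus: "sawtooth (- x) = - sawtooth x"
proof (cases "x \<in> \<int>")
  case False
  then have "\<lceil>x\<rceil> = \<lfloor>x\<rfloor> + 1"
    by (metis Ints_of_int ceiling_altdef)
  with False show ?thesis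
    by (simp add: sawtooth_def floor_minus)
qed (simp add: sawtooth_def)

lemma sawtooth_divide_mod:
  fixes x b :: int
  assumes "b > 0"
  shows "sawtooth (of_int (x mod b) / of_int b) = sawtooth (of_int x / of_int b)"
proof -
  have "of_int x / of_int b = of_int (x mod b) / of_int b + (of_int (x div b) :: real)"
    using assms by (simp add: real_of_int_div4 field_simps flip: of_int_add of_int_mult)
  then show ?thesis
    by (metis sawtooth_add_int)
qed

lemma sawtooth_divide:
  fixes x b :: int
  assumes "b > 0" "\<not> b dvd x"
  shows "sawtooth (of_int x / of_int b) = of_int (x mod b) / of_int b - 1 / 2"
proof -
  have nz: "x mod b > 0" "x mod b < b"
    using assms pos_mod_sign[of b x] by (simp add: dvd_eq_mod_eq_0 order_less_le, simp)
  then have fl: "\<lfloor>of_int (x mod b) / of_int b :: real\<rfloor> = 0"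
    by (simp add: floor_divide_of_int_eq)
  have "of_int (x mod b) / of_int b \<notin> (\<int> :: real set)"
  proof
    assume "of_int (x mod b) / of_int b \<in> (\<int> :: real set)"
    then have "of_int (x mod b) / of_int b = (0 :: real)"
      using fl by (metis Ints_cases floor_of_int of_int_0)
    with nz show False
      by simp
  qed
  then have "sawtooth (of_int (x mod b) / of_int b) = of_int (x mod b) / of_int b - 1 / 2"
    by (simp add: sawtooth_def fl)
  then show ?thesis
    using assms(1) by (simp add: sawtooth_divide_mod)
qed

lemma int_div_less_iff:
  fixes x a k :: int
  assumes "a > 0"
  shows "x div a < k \<longleftrightarrow> x < k * a"
proof
  show "x < k * a" if "x div a < k"
  proof (rule ccontr)
    assume "\<not> x < k * a"
    then have "k * a div a \<le> x div a"
      using assms by (intro zdiv_mono1) auto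
    with assms that show False
      by simp
  qed
  show "x div a < k" if "x < k * a"
  proof (rule ccontr)
    assume "\<not> x div a < k"
    then have "k * a \<le> (x div a) * a"
      using assms by (intro mult_right_mono) auto
    also have "\<dots> \<le> x"
      using assms div_mult_mod_eq[of x a] pos_mod_sign[of a x] by linarith
    finally show False
      using that by simp
  qed
qed

lemma coprime_add_mult_self_iff:
  fixes a b n :: int
  shows "coprime (n * b + a) b \<longleftrightarrow> coprime a b"
  by (simp add: coprime_iff_gcd_eq_1 gcd.commute[of _ b] gcd_add_mult)

lemma bij_betw_mult_mod:
  fixes a b :: int
  assumes "b > 0" "coprime a b"
  shows "bij_betw (\<lambda>k. a * k mod b) {0..<b} {0..<b}"
proof -
  have "inj_on (\<lambda>k. a * k mod b) {0..<b}"
  proof (rule inj_onI)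
    fix x y assume xy: "x \<in> {0..<b}" "y \<in> {0..<b}" "a * x mod b = a * y mod b"
    then have "b dvd a * (x - y)"
      by (simp add: mod_eq_dvd_iff right_diff_distrib)
    then have "b dvd x - y"
      using assms(2) by (simp add: coprime_commute coprime_dvd_mult_right_iff)
    then have "x mod b = y mod b"
      by (simp add: mod_eq_dvd_iff)
    with xy show "x = y"
      by simp
  qed
  moreover have "(\<lambda>k. a * k mod b) ` {0..<b} \<subseteq> {0..<b}"
    using assms(1) by auto
  ultimately show ?thesis
    by (simp add: bij_betw_def endo_inj_surj)
qed

section \<open>Dedekind sums with integer modulus\<close>

text \<open>The modulus is an integer so that the two arguments can be exchanged in the reciprocity
  law. The indices form the residue system \<open>{0..<b}\<close>, which multiplication by a unit
  permutes; starting at \<open>0\<close> instead of ending at \<open>b\<close> is harmless, as both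
  terms vanish.\<close>

definition int_dedekind_sum :: "int \<Rightarrow> int \<Rightarrow> real" where
  "int_dedekind_sum a b =
     (\<Sum>k = 0..<b. sawtooth (of_int k / of_int b) * sawtooth (of_int (a * k) / of_int b))"

lemma dedekind_sum_eq_int_dedekind_sum:
  assumes "b > 0"
  shows "dedekind_sum a b = int_dedekind_sum a (int b)"
proof -
  let ?f = "\<lambda>k::nat. sawtooth (real k / real b) * sawtooth (of_int a * real k / real b)"
  have "dedekind_sum a b = sum ?f {1..<b}"
    unfolding dedekind_sum_def using assms
    by (intro sum.mono_neutral_right) (auto simp: sawtooth_def)
  also have "\<dots> = sum ?f {0..<b}"
    by (intro sum.mono_neutral_left) (auto simp: sawtooth_def not_le)
  also have "\<dots> = int_dedekind_sum a (int b)"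
    unfolding int_dedekind_sum_def
    by (rule sum.reindex_bij_witness[of _ nat int]) auto
  finally show ?thesis .
qed

lemma int_dedekind_sum_cong:
  assumes "b > 0" "a mod b = c mod b"
  shows "int_dedekind_sum a b = int_dedekind_sum c b"
  unfolding int_dedekind_sum_def
proof (intro sum.cong refl arg_cong2[where f = "(*)"])
  fix k
  have "a * k mod b = c * k mod b"
    using assms(2) by (metis mod_mult_left_eq)
  then show "sawtooth (of_int (a * k) / of_int b) = sawtooth (of_int (c * k) / of_int b)"
    using assms(1) by (metis sawtooth_divide_mod)
qed

lemma int_dedekind_sum_minus: "int_dedekind_sum (- a) b = - int_dedekind_sum a b"
  by (simp add: int_dedekind_sum_def sawtooth_minus sum_negf)

text \<open>The substitution of \<open>c * k mod b\<close> for \<open>k\<close> permutes the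
  residues and interchanges the roles of the two sawtooth factors.\<close>

lemma int_dedekind_sum_inverse:
  assumes "b > 0" "a * c mod b = 1 mod b"
  shows "int_dedekind_sum a b = int_dedekind_sum c b"
proof -
  have "coprime (a * c) b"
    using assms by (metis coprime_1_left coprime_mod_left_iff less_irrefl)
  then have cop: "coprime c b"
    by simp
  let ?h = "\<lambda>k. sawtooth (of_int k / of_int b) * sawtooth (of_int (a * k) / of_int b)"
  have "int_dedekind_sum a b = (\<Sum>k = 0..<b. ?h (c * k mod b))"
    unfolding int_dedekind_sum_def
    by (rule sum.reindex_bij_betw[OF bij_betw_mult_mod[OF assms(1) cop], symmetric])
  also have "\<dots> = int_dedekind_sum c b"
    unfolding int_dedekind_sum_def
  proof (intro sum.cong refl)
    fix k
    have "a * (c * k mod b) mod b = k mod b"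
      using assms(2) by (metis mod_mult_left_eq mod_mult_right_eq mult.assoc mult_1)
    then have "sawtooth (of_int (a * (c * k mod b)) / of_int b) = sawtooth (of_int k / of_int b)"
      using assms(1) by (metis sawtooth_divide_mod)
    then show "?h (c * k mod b) =
        sawtooth (of_int k / of_int b) * sawtooth (of_int (c * k) / of_int b)"
      using assms(1) by (simp add: sawtooth_divide_mod del: of_int_mult)
  qed
  finally show ?thesis .
qed

section \<open>Reciprocity law\<close>

lemma sum_int_lessThan:
  fixes b :: int
  assumes "b \<ge> 0"
  shows "2 * (\<Sum>k = 0..<b. k) = b * (b - 1)"
  using assms
proof (induction b rule: int_ge_induct)
  case (step i)
  then have "{0..<i + 1} = insert i {0..<i}" by auto
  with step show ?case by (simp add: algebra_simps)
qed simp

lemma sum_int_squares_lessThan: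
  fixes b :: int
  assumes "b \<ge> 0"
  shows "6 * (\<Sum>k = 0..<b. k\<^sup>2) = b * (b - 1) * (2 * b - 1)"
  using assms
proof (induction b rule: int_ge_induct)
  case (step i)
  then have "{0..<i + 1} = insert i {0..<i}" by auto
  with step show ?case by (simp add: algebra_simps power2_eq_square)
qed simp

lemma sum_mult_mod:
  fixes a b :: int and f :: "int \<Rightarrow> int"
  assumes "b > 0" "coprime a b"
  shows "(\<Sum>k = 0..<b. f (a * k mod b)) = (\<Sum>k = 0..<b. f k)"
  by (rule sum.reindex_bij_betw[OF bij_betw_mult_mod[OF assms]])

text \<open>Away from \<open>k = 0\<close> both factors are a residue over \<open>b\<close> minus
  \<open>1 / 2\<close>. In the expanded product the two linear sums agree, since multiplication by
  \<open>a\<close> permutes the residues; in the quadratic one, \<open>a * k mod b\<close> becomes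
  \<open>a * k - b * (a * k div b)\<close>.\<close>

lemma int_dedekind_sum_eq_floor_sum:
  assumes "b > 0" "coprime a b"
  shows "int_dedekind_sum a b =
    of_int a * of_int ((b - 1) * (2 * b - 1)) / of_int (6 * b)
      - of_int (\<Sum>k = 0..<b. k * (a * k div b)) / of_int b - of_int (b - 1) / 4"
proof -
  let ?R = "\<Sum>k = 0..<b. k * (a * k mod b)"
  \<comment> \<open>The index \<open>0\<close> is split off because the linear formula for the
    sawtooth fails there; \<open>s0\<close> restores it once every summand vanishes at
    \<open>0\<close>.\<close>
  have ins: "{0..<b} = insert 0 {1..<b}" using assms by auto
  have s0: "(\<Sum>k = 1..<b. f k) = (\<Sum>k = 0..<b. f k)" if "f 0 = 0" for f :: "int \<Rightarrow> int"
    unfolding ins using that by simp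
  have "int_dedekind_sum a b = (\<Sum>k = 1..<b.
      (of_int k / of_int b - 1 / 2) * (of_int (a * k mod b) / of_int b - 1 / 2))"
    unfolding int_dedekind_sum_def
  proof (rule sum.mono_neutral_cong_right)
    fix k assume k: "k \<in> {1..<b}"
    then have nd: "\<not> b dvd k" by (auto dest: zdvd_imp_le)
    then have nd': "\<not> b dvd a * k"
      using assms(2) by (simp add: coprime_commute coprime_dvd_mult_right_iff)
    show "sawtooth (of_int k / of_int b) * sawtooth (of_int (a * k) / of_int b) =
       (of_int k / of_int b - 1 / 2) * (of_int (a * k mod b) / of_int b - 1 / 2)"
      using sawtooth_divide[OF assms(1) nd] sawtooth_divide[OF assms(1) nd'] k
      by simp
  qed (auto simp: ins sawtooth_def)
  also have "\<dots> = (\<Sum>k = 1..<b. of_int (k * (a * k mod b)) / (of_int b)\<^sup>2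
      - of_int k / of_int (2 * b) - of_int (a * k mod b) / of_int (2 * b) + 1 / 4)"
    by (rule sum.cong) (use assms in \<open>auto simp: field_simps power2_eq_square\<close>)
  also have "\<dots> = of_int (\<Sum>k = 1..<b. k * (a * k mod b)) / (of_int b)\<^sup>2
      - of_int (\<Sum>k = 1..<b. k) / of_int (2 * b)
      - of_int (\<Sum>k = 1..<b. a * k mod b) / of_int (2 * b) + of_int (b - 1) / 4"
    using assms(1)
    by (simp only: sum.distrib sum_subtractf of_int_sum sum_divide_distrib[symmetric] sum_constant)
       simp
  also have "\<dots> = of_int ?R / (of_int b)\<^sup>2 - 2 * (of_int (\<Sum>k = 0..<b. k) / of_int (2 * b))
      + of_int (b - 1) / 4"
    using sum_mult_mod[OF assms, of "\<lambda>x. x"] by (simp add: s0)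
  also have "of_int (\<Sum>k = 0..<b. k) = (of_int (b * (b - 1)) / 2 :: real)"
    unfolding sum_int_lessThan[OF less_imp_le[OF assms(1)], symmetric] by simp
  also have "?R = a * (\<Sum>k = 0..<b. k\<^sup>2) - b * (\<Sum>k = 0..<b. k * (a * k div b))"
    unfolding sum_distrib_left sum_subtractf[symmetric]
    by (rule sum.cong) (auto simp: minus_mult_div_eq_mod[symmetric] algebra_simps power2_eq_square)
  finally have "int_dedekind_sum a b =
    of_int (a * (\<Sum>k = 0..<b. k\<^sup>2) - b * (\<Sum>k = 0..<b. k * (a * k div b))) / (of_int b)\<^sup>2
      - 2 * (of_int (b * (b - 1)) / 2 / of_int (2 * b)) + of_int (b - 1) / 4" .
  moreover have "of_int (\<Sum>k = 0..<b. k\<^sup>2) = (of_int (b * (b - 1) * (2 * b - 1)) / 6 :: real)"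
    unfolding sum_int_squares_lessThan[OF less_imp_le[OF assms(1)], symmetric] by simp
  ultimately have "int_dedekind_sum a b =
    (of_int a * (of_int (b * (b - 1) * (2 * b - 1)) / 6)
      - of_int b * of_int (\<Sum>k = 0..<b. k * (a * k div b))) / (of_int b)\<^sup>2
      - 2 * (of_int (b * (b - 1)) / 2 / of_int (2 * b)) + of_int (b - 1) / 4"
    by (simp only: of_int_diff of_int_mult)
  then show ?thesis
    by (rule trans) (use assms(1) in \<open>simp add: field_simps power2_eq_square del: of_int_sum\<close>)
qed

text \<open>Both sides count the lattice points \<open>(k, j)\<close> with \<open>0 < k < b\<close>, \<open>0 < j\<close>
  and \<open>j b < a k\<close>, weighted by \<open>2 j\<close>.\<close>

lemma sum_floor_double_count:
  fixes a b :: int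
  assumes "a > 0" "b > 0" "coprime a b"
  shows "(\<Sum>k = 0..<b. (a * k div b) * (a * k div b + 1)) =
    (\<Sum>j = 0..<a. 2 * j * (b - 1 - b * j div a))"
proof -
  have "(\<Sum>k = 0..<b. (a * k div b) * (a * k div b + 1)) =
      (\<Sum>k = 0..<b. \<Sum>j = 0..<a. if j \<le> a * k div b then 2 * j else 0)"
  proof (rule sum.cong[OF refl])
    fix k assume k: "k \<in> {0..<b}"
    let ?f = "a * k div b"
    have f: "0 \<le> ?f" "?f < a"
      using k assms by (auto simp: pos_imp_zdiv_nonneg_iff int_div_less_iff)
    have "(\<Sum>j = 0..<a. if j \<le> ?f then 2 * j else 0) = (\<Sum>j = 0..<?f + 1. 2 * j)"
      by (rule sum.mono_neutral_cong_right) (use f in auto)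
    also have "\<dots> = ?f * (?f + 1)"
      using sum_int_lessThan[of "?f + 1"] f by (simp add: sum_distrib_left mult.commute)
    finally show "?f * (?f + 1) = (\<Sum>j = 0..<a. if j \<le> ?f then 2 * j else 0)" ..
  qed
  also have "\<dots> = (\<Sum>j = 0..<a. \<Sum>k = 0..<b. if j \<le> a * k div b then 2 * j else 0)"
    by (rule sum.swap)
  also have "\<dots> = (\<Sum>j = 0..<a. 2 * j * (b - 1 - b * j div a))"
  proof (rule sum.cong[OF refl])
    fix j assume j: "j \<in> {0..<a}"
    show "(\<Sum>k = 0..<b. if j \<le> a * k div b then 2 * j else 0) = 2 * j * (b - 1 - b * j div a)"
    \<comment> \<open>The weight \<open>2 * j\<close> is zero at \<open>j = 0\<close>, the one row
      containing a lattice point on the line \<open>b * j = a * k\<close>. For other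
      \<open>j\<close>, coprimality excludes such points, so weak and strict inequality
      agree.\<close>
    proof (cases "j = 0")
      case False
      let ?g = "b * j div a"
      have g: "0 \<le> ?g" "?g < b"
        using j assms by (auto simp: pos_imp_zdiv_nonneg_iff int_div_less_iff)
      have "\<not> a dvd j"
        using j False by (auto dest: zdvd_imp_le)
      then have nd: "\<not> a dvd b * j"
        using assms(3) by (simp add: coprime_dvd_mult_right_iff)
      have iff: "j \<le> a * k div b \<longleftrightarrow> ?g < k" for k
      proof -
        have "j \<le> a * k div b \<longleftrightarrow> b * j \<le> a * k"
          using assms(2) by (simp add: int_div_less_iff mult.commute flip: not_less)
        also have "\<dots> \<longleftrightarrow> b * j < a * k"
          using nd by (metis dvd_triv_left order_less_le)
        also have "\<dots> \<longleftrightarrow> ?g < k"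
          using assms(1) by (simp add: int_div_less_iff mult.commute)
        finally show ?thesis .
      qed
      have "(\<Sum>k = 0..<b. if ?g < k then 2 * j else 0) = (\<Sum>k = ?g + 1..<b. 2 * j)"
        by (rule sum.mono_neutral_cong_right) (use g in auto)
      also have "\<dots> = 2 * j * (b - 1 - ?g)"
        using g by (simp add: algebra_simps)
      finally show ?thesis
        by (simp only: iff)
    qed (auto intro: sum.neutral)
  qed
  finally show ?thesis .
qed

text \<open>By the floor-sum formula only \<open>12 * a * X + 12 * b * Z\<close> has to be
  evaluated. The second moment of the residues \<open>a * k mod b\<close> ties \<open>X\<close> to
  \<open>Y\<close>, the lattice point count ties \<open>Y\<close> to \<open>Z\<close>, and the first
  moment gives \<open>F\<close>.\<close>

theorem int_dedekind_sum_reciprocity: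
  fixes a b :: int
  assumes "a > 0" "b > 0" "coprime a b"
  shows "12 * (int_dedekind_sum a b + int_dedekind_sum b a) =
    - 3 + of_int (a\<^sup>2 + b\<^sup>2 + 1) / of_int (a * b)"
proof -
  define F where "F = (\<Sum>k = 0..<b. a * k div b)"
  define X where "X = (\<Sum>k = 0..<b. k * (a * k div b))"
  define Y where "Y = (\<Sum>k = 0..<b. (a * k div b)\<^sup>2)"
  define Z where "Z = (\<Sum>j = 0..<a. j * (b * j div a))"
  define Q where "Q = (\<Sum>k = 0..<b. k\<^sup>2)"
  note perm = sum_mult_mod[OF assms(2,3)]
  have Q: "6 * Q = b * (b - 1) * (2 * b - 1)"
    using sum_int_squares_lessThan[of b] assms by (simp add: Q_def)
  have "(\<Sum>k = 0..<b. k) = (\<Sum>k = 0..<b. a * k - b * (a * k div b))"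
    using perm[of "\<lambda>x. x"] by (simp add: minus_mult_div_eq_mod)
  then have "b * F = (a - 1) * (\<Sum>k = 0..<b. k)"
    by (simp add: sum_subtractf F_def left_diff_distrib flip: sum_distrib_left)
  then have "b * (2 * F) = b * ((a - 1) * (b - 1))"
    using sum_int_lessThan[OF less_imp_le[OF assms(2)]] by algebra
  then have F: "2 * F = (a - 1) * (b - 1)"
    using assms(2) by simp
  have "Q = (\<Sum>k = 0..<b. (a * k - b * (a * k div b))\<^sup>2)"
    using perm[of "\<lambda>x. x\<^sup>2"] by (simp add: minus_mult_div_eq_mod Q_def)
  also have "\<dots> = (\<Sum>k = 0..<b. a\<^sup>2 * k\<^sup>2 - 2 * a * b * (k * (a * k div b)) + b\<^sup>2 * (a * k div b)\<^sup>2)"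
    by (rule sum.cong) (auto simp: power2_eq_square algebra_simps)
  finally have Y: "Q = a\<^sup>2 * Q - 2 * a * b * X + b\<^sup>2 * Y"
    by (simp add: sum.distrib sum_subtractf Q_def X_def Y_def flip: sum_distrib_left)
  have "Y + F = (\<Sum>k = 0..<b. (a * k div b) * (a * k div b + 1))"
    by (simp add: Y_def F_def sum.distrib distrib_left power2_eq_square)
  also have "\<dots> = (\<Sum>j = 0..<a. (b - 1) * (2 * j) - 2 * (j * (b * j div a)))"
    unfolding sum_floor_double_count[OF assms] by (rule sum.cong) (auto simp: algebra_simps)
  also have "\<dots> = (b - 1) * (2 * (\<Sum>j = 0..<a. j)) - 2 * Z"
    by (simp add: sum_subtractf Z_def sum_distrib_left)
  also have "2 * (\<Sum>j = 0..<a. j) = a * (a - 1)"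
    using assms by (simp add: sum_int_lessThan)
  finally have Z: "Y + F = (b - 1) * (a * (a - 1)) - 2 * Z" .
  have ab: "int_dedekind_sum a b = of_int a * of_int ((b - 1) * (2 * b - 1)) / of_int (6 * b)
      - of_int X / of_int b - of_int (b - 1) / 4"
    unfolding X_def by (rule int_dedekind_sum_eq_floor_sum) (use assms in auto)
  have ba: "int_dedekind_sum b a = of_int b * of_int ((a - 1) * (2 * a - 1)) / of_int (6 * a)
      - of_int Z / of_int a - of_int (a - 1) / 4"
    unfolding Z_def by (rule int_dedekind_sum_eq_floor_sum) (use assms in \<open>auto simp: coprime_commute\<close>)
  \<comment> \<open>Six times \<open>Y\<close> plus \<open>6 * b\<^sup>2\<close> times
    \<open>Z\<close> eliminates the sum \<open>Y\<close>; the common factor \<open>b\<close> is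
    cancelled afterwards.\<close>
  have "b * (12 * a * X + 12 * b * Z) =
      b * (2 * a\<^sup>2 * (b - 1) * (2 * b - 1) + 2 * b\<^sup>2 * (a - 1) * (2 * a - 1)
        - 3 * a * b * (b - 1) - 3 * a * b * (a - 1) + 3 * a * b - a\<^sup>2 - b\<^sup>2 - 1)"
    using Q F Y Z by algebra
  then have "12 * a * X + 12 * b * Z =
      2 * a\<^sup>2 * (b - 1) * (2 * b - 1) + 2 * b\<^sup>2 * (a - 1) * (2 * a - 1)
        - 3 * a * b * (b - 1) - 3 * a * b * (a - 1) + 3 * a * b - a\<^sup>2 - b\<^sup>2 - 1"
    using assms(2) by simp
  then have XZ: "of_int (12 * a * X + 12 * b * Z) =
      (of_int (2 * a\<^sup>2 * (b - 1) * (2 * b - 1) + 2 * b\<^sup>2 * (a - 1) * (2 * a - 1)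
        - 3 * a * b * (b - 1) - 3 * a * b * (a - 1) + 3 * a * b - a\<^sup>2 - b\<^sup>2 - 1) :: real)"
    by (simp only:)
  have "12 * (int_dedekind_sum a b + int_dedekind_sum b a) =
      (of_int (2 * a\<^sup>2 * (b - 1) * (2 * b - 1) + 2 * b\<^sup>2 * (a - 1) * (2 * a - 1)
        - 3 * a * b * (b - 1) - 3 * a * b * (a - 1)) - of_int (12 * a * X + 12 * b * Z))
      / of_int (a * b)"
    unfolding ab ba using assms(1,2) by (simp add: field_simps power2_eq_square)
  then show ?thesis
    unfolding XZ using assms(1,2) by (simp add: field_simps)
qed

section \<open>Farey neighbours and parabolic elements\<close>

text \<open>The determinant condition makes \<open>c\<close> inverse to \<open>b\<close> modulo
  \<open>d\<close>, and \<open>- a\<close> inverse to \<open>d\<close> modulo \<open>b\<close>.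
  Hence the difference is the sum of the Dedekind sums of \<open>(b, d)\<close> and
  \<open>(d, b)\<close>, to which reciprocity applies.\<close>

lemma int_dedekind_sum_farey_neighbours:
  fixes a b c d :: int
  assumes "b > 0" "d > 0" "c * b - a * d = 1"
  shows "12 * (int_dedekind_sum c d - int_dedekind_sum a b) =
    - 3 + of_int (b\<^sup>2 + d\<^sup>2 + 1) / of_int (b * d)"
proof -
  have "c * b = 1 + a * d" "- a * d = 1 + (- c) * b"
    using assms(3) by simp_all
  then have inv: "c * b mod d = 1 mod d" "(- a) * d mod b = 1 mod b"
    by (metis mod_mult_self1)+
  have "coprime b d"
  proof (rule coprimeI)
    fix e assume "e dvd b" "e dvd d"
    then have "e dvd c * b - a * d" by simp
    then show "is_unit e" by (simp add: assms(3))
  qed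
  moreover have "int_dedekind_sum c d = int_dedekind_sum b d"
    using int_dedekind_sum_inverse inv(1) assms(2) by blast
  moreover have "- int_dedekind_sum a b = int_dedekind_sum d b"
    using int_dedekind_sum_inverse inv(2) assms(1) by (metis int_dedekind_sum_minus)
  ultimately show ?thesis
    using int_dedekind_sum_reciprocity[of b d] assms by simp
qed

text \<open>The map \<open>(c, d) \<mapsto> (c + j q a, d + j q b)\<close>, \<open>q = c b - a d\<close>, is the unipotent element of
  \<open>SL\<^sub>2(\<int>)\<close> fixing \<open>(a, b)\<close>. It maps Farey neighbours to Farey neighbours, so one can induct along
  a Farey path from \<open>(a, b)\<close> to \<open>(c, d)\<close>.\<close>

lemma int_dedekind_sum_shear:
  fixes a b c d j :: int
  assumes "b > 0" "d > 0" "j \<ge> 0" "coprime a b" "coprime c d" "c * b - a * d = q" "q > 0"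
  shows "12 * (int_dedekind_sum (c + j * q * a) (d + j * q * b) - int_dedekind_sum c d) =
    of_int j + (of_int b / of_int q + of_int q / of_int b)
      * (1 / of_int (d + j * q * b) - 1 / of_int d)"
  using assms
proof (induction "nat q" arbitrary: c d q rule: less_induct)
  case less
  define d' where "d' = d + j * q * b"
  have d': "d' > 0"
    using less.prems by (simp add: d'_def add_pos_nonneg)
  show ?case
  proof (cases "q = 1")
    case True
    have "(c + j * a) * b - a * d' = 1"
      using less.prems True by (simp add: d'_def algebra_simps)
    \<comment> \<open>Both \<open>(c, d)\<close> and its image are Farey neighbours of
      \<open>(a, b)\<close>, so the Dedekind sum of \<open>(a, b)\<close> cancels.\<close>
    from int_dedekind_sum_farey_neighbours[OF less.prems(1) d' this]
      int_dedekind_sum_farey_neighbours[OF less.prems(1,2), of c a]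
    have "12 * (int_dedekind_sum (c + j * a) d' - int_dedekind_sum c d) =
        of_int (b\<^sup>2 + d'\<^sup>2 + 1) / of_int (b * d') - of_int (b\<^sup>2 + d\<^sup>2 + 1) / of_int (b * d)"
      using less.prems True by simp
    also have "\<dots> = of_int (d' - d) / of_int b
        + (of_int b + 1 / of_int b) * (1 / of_int d' - 1 / of_int d)"
      using less.prems(1,2) d' by (simp add: field_simps power2_eq_square)
    also have "of_int (d' - d) / of_int b = (of_int j :: real)"
      using less.prems(1) True by (simp add: d'_def)
    finally show ?thesis
      using True by (simp add: d'_def)
  next
    case False
    \<comment> \<open>The next vertex \<open>(e, f)\<close> of the path is a Farey neighbour of
      \<open>(c, d)\<close>. Bezout gives one solution of \<open>c * f - e * d = 1\<close>; adding
      multiples of \<open>(c, d)\<close> reduces its determinant with \<open>(a, b)\<close> modulo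
      \<open>q\<close>. The remainder \<open>r\<close> is the smaller determinant for the
      induction.\<close>
    obtain s t where st: "s * c + t * d = 1"
      using less.prems(5) by (metis bezout_int coprime_imp_gcd_eq_1)
    define l where "l = - (t * b + s * a) div q"
    define r where "r = - (t * b + s * a) mod q"
    define e where "e = - t - l * c"
    define f where "f = s - l * d"
    have ef: "c * f - e * d = 1"
      using st by (simp add: e_def f_def algebra_simps)
    have "e * b - a * f = - (t * b + s * a) - l * (c * b - a * d)"
      by (simp add: e_def f_def algebra_simps)
    then have r: "e * b - a * f = r"
      by (simp add: less.prems(6) l_def r_def minus_div_mult_eq_mod)
    have qe: "q * e = a + r * c" and qf: "q * f = b + r * d"
      using ef r less.prems(6) by algebra+
    have "r \<noteq> 0"
    proof
      assume "r = 0"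
      then have "q dvd a" "q dvd b"
        using qe qf by (metis add_0_right dvd_triv_left mult_zero_left)+
      then have "is_unit q"
        using less.prems(4) coprime_common_divisor by blast
      with False less.prems(7) show False
        by simp
    qed
    then have r_bounds: "0 < r" "r < q"
      using less.prems(7) pos_mod_sign[of q "- (t * b + s * a)"]
      by (simp add: r_def order_less_le, simp add: r_def)
    have "q * f > 0"
      unfolding qf using r_bounds less.prems by (simp add: add_pos_pos)
    then have f: "f > 0"
      using less.prems(7) by (simp add: zero_less_mult_iff)
    have "coprime e f"
    proof (rule coprimeI)
      fix g assume "g dvd e" "g dvd f"
      then have "g dvd c * f - e * d" by simp
      then show "is_unit g" by (simp add: ef)
    qed
    define f' where "f' = f + j * r * b"
    have f': "f' > 0"
      using less.prems f r_bounds by (simp add: f'_def add_pos_nonneg)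
    have qf': "q * f' = b + r * d'"
      using qf by (simp add: f'_def d'_def algebra_simps)
    \<comment> \<open>The unipotent map preserves determinants, so the images of
      \<open>(c, d)\<close> and \<open>(e, f)\<close> are again Farey neighbours.\<close>
    have ef': "(c + j * q * a) * f' - (e + j * r * a) * d' = 1"
      unfolding f'_def d'_def using ef r less.prems(6) by algebra
    have IH: "12 * (int_dedekind_sum (e + j * r * a) f' - int_dedekind_sum e f) =
        of_int j + (of_int b / of_int r + of_int r / of_int b) * (1 / of_int f' - 1 / of_int f)"
      unfolding f'_def
      by (rule less.hyps) (use less.prems r_bounds f r \<open>coprime e f\<close> in auto)
    \<comment> \<open>With \<open>g m = b / m + m / b\<close>, the edge term is a constant plus
      \<open>g q / x - g r / y\<close>. For an edge and its image the constants cancel, and the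
      \<open>g r\<close> terms cancel against the induction hypothesis; this is the
      telescoping.\<close>
    have weight: "of_int (y\<^sup>2 + x\<^sup>2 + 1) / of_int (y * x) =
        of_int r / of_int q + of_int q / of_int r
        + (of_int b / of_int q + of_int q / of_int b) / of_int x
        - (of_int b / of_int r + of_int r / of_int b) / (of_int y :: real)"
      if "x > 0" "y > 0" "q * y = b + r * x" for x y :: int
    proof -
      have b: "real_of_int b = of_int q * of_int y - of_int r * of_int x"
        using that(3) by (simp flip: of_int_mult of_int_add)
      have nz: "real_of_int x \<noteq> 0" "real_of_int y \<noteq> 0" "real_of_int q \<noteq> 0" "real_of_int r \<noteq> 0"
        "real_of_int b \<noteq> 0"
        using that r_bounds less.prems by auto
      have "of_int b / (of_int q * of_int x) = of_int y / of_int x - of_int r / (of_int q :: real)"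
        "of_int b / (of_int r * of_int y) = of_int q / of_int r - of_int x / (of_int y :: real)"
        using nz(1-4) by (simp_all add: b field_simps)
      moreover have "of_int q / (of_int b * of_int x) - of_int r / (of_int b * of_int y) =
          1 / (of_int x * of_int y :: real)"
      proof -
        have "of_int q / (of_int b * of_int x) - of_int r / (of_int b * of_int y) =
            (of_int q * of_int y - of_int r * of_int x) / (of_int b * (of_int x * of_int y) :: real)"
          using nz by (simp add: diff_divide_distrib)
        then show ?thesis
          using nz by (simp flip: b)
      qed
      ultimately show ?thesis
        using nz by (simp add: add_divide_distrib power2_eq_square mult.commute)
    qed
    show ?thesis
      using IH int_dedekind_sum_farey_neighbours[OF f less.prems(2) ef]
        int_dedekind_sum_farey_neighbours[OF f' d' ef']
        weight[OF less.prems(2) f qf] weight[OF d' f' qf']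
      by (simp add: d'_def[symmetric] right_diff_distrib)
  qed
qed

section \<open>Infinitely many pairs with the same value\<close>

text \<open>The shear formula is applied with \<open>j = n\<close> to \<open>(a + b * n, b)\<close>,
  whose Dedekind sum is that of \<open>(a, b)\<close> by periodicity. The choice of \<open>k\<close>
  makes the two terms of the formula equal to \<open>n\<close> and \<open>- n\<close>.\<close>

lemma int_dedekind_sum_invariance:
  fixes a b n :: int
  assumes "b > 0" "n > 0" "coprime a b"
  defines "k \<equiv> (b * n)\<^sup>2 + 1"
  shows "int_dedekind_sum (a * k + b * n) (b * k) = int_dedekind_sum a b"
proof -
  \<comment> \<open>This is the determinant of \<open>(a + b * n, b)\<close> with
    \<open>(a, b)\<close>; the sheared denominator \<open>b + n * q * b\<close> is then
    \<open>b * k\<close>.\<close>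
  define q where "q = b\<^sup>2 * n"
  have arg: "a + b * n + n * q * a = a * k + b * n" "b + n * q * b = b * k"
    by (simp_all add: k_def q_def algebra_simps power2_eq_square)
  have cop: "coprime (a + b * n) b"
    using assms(3) coprime_add_mult_self_iff[of n b a] by (simp add: add.commute mult.commute)
  have "(a + b * n) * b - a * b = q" "q > 0"
    using assms(1,2) by (simp_all add: q_def algebra_simps power2_eq_square)
  from int_dedekind_sum_shear[OF assms(1,1) _ assms(3) cop this, of n]
  have "12 * (int_dedekind_sum (a * k + b * n) (b * k) - int_dedekind_sum (a + b * n) b) =
      of_int n + (of_int b / of_int q + of_int q / of_int b) * (1 / of_int (b * k) - 1 / of_int b)"
    using assms(2) by (simp add: arg)
  also have "\<dots> = 0"
  proof -
    have "of_int b / of_int q + of_int q / of_int b = (of_int k / of_int (b * n) :: real)"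
      using assms(1,2) by (simp add: k_def q_def field_simps power2_eq_square)
    moreover have "1 / of_int (b * k) - 1 / of_int b = (of_int (1 - k) / of_int (b * k) :: real)"
      using assms(1) by (simp add: k_def field_simps add_nonneg_eq_0_iff)
    moreover have "1 - k = - (n * (b * (b * n)))"
      by (simp add: k_def power2_eq_square)
    moreover have "k > 0"
      by (simp add: k_def add_nonneg_pos)
    ultimately show ?thesis
      using assms(1,2) by simp
  qed
  finally have "int_dedekind_sum (a * k + b * n) (b * k) = int_dedekind_sum (a + b * n) b"
    by simp
  also have "\<dots> = int_dedekind_sum a b"
    using assms(1) by (intro int_dedekind_sum_cong) simp_all
  finally show ?thesis .
qed

text \<open>The numerator is congruent to \<open>b * n\<close> modulo \<open>k\<close> and to
  \<open>a\<close> modulo \<open>b\<close>; both are units there, since \<open>k\<close> is one more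
  than the square of \<open>b * n\<close>.\<close>

lemma coprime_shifted_multiple:
  fixes a b n :: int
  assumes "coprime a b"
  defines "k \<equiv> (b * n)\<^sup>2 + 1"
  shows "coprime (a * k + b * n) (b * k)"
proof -
  have "coprime (b * n) k"
  proof (rule coprimeI)
    fix g assume g: "g dvd b * n" "g dvd k"
    then have "g dvd k - (b * n) * (b * n)"
      using dvd_diff dvd_mult by blast
    then show "is_unit g"
      by (simp add: k_def power2_eq_square)
  qed
  then have "coprime (a * k + b * n) k"
    by (simp add: coprime_add_mult_self_iff)
  moreover have "a * k + b * n = (a * b * n * n + n) * b + a"
    by (simp add: k_def algebra_simps power2_eq_square)
  then have "coprime (a * k + b * n) b"
    using assms(1) by (simp only: coprime_add_mult_self_iff)
  ultimately show ?thesis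
    by simp
qed

theorem theorem1:
  fixes r :: rat
  assumes "\<exists>(a :: int) (b :: nat). b > 0 \<and> coprime a (int b) \<and>
             normalized_dedekind_sum a b = of_rat r"
  shows "\<exists>(a :: nat \<Rightarrow> int) (b :: nat \<Rightarrow> nat).
           (\<forall>i. b i > 0 \<and> coprime (a i) (int (b i))) \<and>
           filterlim b at_top sequentially \<and>
           (\<forall>i. normalized_dedekind_sum (a i) (b i) = of_rat r)"
proof -
  obtain a :: int and b :: nat where ab: "b > 0" "coprime a (int b)"
    "normalized_dedekind_sum a b = of_rat r"
    using assms by blast
  \<comment> \<open>The parameter \<open>n\<close> is taken to be \<open>Suc i\<close>, as the
    invariance requires it to be positive.\<close>
  define k where "k i = (b * Suc i)\<^sup>2 + 1" for i
  have k: "int (k i) = (int b * int (Suc i))\<^sup>2 + 1" for i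
    unfolding k_def by (simp only: of_nat_add of_nat_mult of_nat_power of_nat_1)
  have pos: "b * k i > 0" for i
    using ab(1) by (simp add: k_def)
  let ?A = "\<lambda>i. a * int (k i) + int b * int (Suc i)" and ?B = "\<lambda>i. b * k i"
  have "coprime (?A i) (int (?B i))" for i
    using coprime_shifted_multiple[OF ab(2), of "int (Suc i)"] 
    unfolding k of_nat_mult .
  moreover have "normalized_dedekind_sum (?A i) (?B i) = of_rat r" for i
  proof -
    have "int_dedekind_sum (?A i) (int (?B i)) = int_dedekind_sum a (int b)"
      unfolding k of_nat_mult using ab by (intro int_dedekind_sum_invariance) auto
    then show ?thesis
      using ab(3) unfolding normalized_dedekind_sum_def
        dedekind_sum_eq_int_dedekind_sum[OF pos] dedekind_sum_eq_int_dedekind_sum[OF ab(1)]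
      by (simp only:)
  qed
  moreover have "filterlim ?B at_top sequentially"
  proof (rule filterlim_at_top_mono[OF filterlim_ident always_eventually], rule allI)
    fix i
    have "i \<le> 1 * Suc i"
      by simp
    also have "\<dots> \<le> b * Suc i"
      using ab(1) by (intro mult_le_mono1) simp
    also have "\<dots> \<le> k i"
      unfolding k_def power2_eq_square by (simp only: le_square trans_le_add1)
    also have "\<dots> \<le> b * k i"
      using ab(1) by simp
    finally show "i \<le> b * k i" .
  qed
  ultimately show ?thesis
    using pos by (intro exI[of _ ?A] exI[of _ ?B] conjI allI) simp_all
qed

end
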